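(* For any integer $n \geq 4$, let $v$ be a vertex of the complete graph $K_n$ and let $H_n$ be the graph obtained from $K_n$ by subdividing once each edge incident with $v$. Then $H_n$ is $(n+1)$-critical but not 1-unique; moreover, $v$ is the only non-1-unique vertex in $H_n$.
   Context: Graphs are finite and simple (loops and parallel edges produced by edge contraction are discarded). A labeling of a graph $G$ assigns a positive integer to each vertex. A labeling is feasible if every path between two distinct vertices with the same label contains a vertex having a higher label. The tree-depth $\operatorname{td}(G)$ is the smallest $k$ for which $G$ has a feasible labeling with labels from $\{1,\dots,k\}$. A graph $G$ is $k$-critical if $\operatorname{td}(G)=k$ and every proper minor of $G$ has tree-depth strictly less than $k$. A vertex $v$ of $G$ is 1-unique if there is a feasible labeling of $G$ with labels from $\{1,\dots,\operatorname{td}(G)\}$ in which $v$ is the unique vertex receiving the label 1; the graph $G$ is 1-unique if all of its vertices are 1-unique. *)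

theory Defs
  imports Main
begin

record 'a sgraph =
  verts :: "'a set"
  edges :: "'a set set"

definition simple_graph :: "'a sgraph \<Rightarrow> bool" where
  "simple_graph G \<longleftrightarrow> finite (verts G) \<and> (\<forall>e\<in>edges G. e \<subseteq> verts G \<and> card e = 2)"

definition complete_graph :: "'a set \<Rightarrow> 'a sgraph" where
  "complete_graph V = \<lparr>verts = V, edges = {e. e \<subseteq> V \<and> card e = 2}\<rparr>"

text \<open>
  Subdividing once every edge in \<open>F\<close>: the original vertex \<open>x\<close> becomes \<open>Inl x\<close>,
  and \<open>Inr e\<close> is the new vertex in the middle of the edge \<open>e\<close>.
\<close>

definition subdivide :: "'a sgraph \<Rightarrow> 'a set set \<Rightarrow> ('a + 'a set) sgraph" where
  "subdivide G F =
     \<lparr>verts = Inl ` verts G \<union> Inr ` F,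
      edges = (\<lambda>e. Inl ` e) ` (edges G - F) \<union> {{Inl x, Inr e} | x e. e \<in> F \<and> x \<in> e}\<rparr>"

definition is_path :: "'a sgraph \<Rightarrow> 'a list \<Rightarrow> bool" where
  "is_path G p \<longleftrightarrow>
     p \<noteq> [] \<and> distinct p \<and> set p \<subseteq> verts G \<and> successively (\<lambda>x y. {x, y} \<in> edges G) p"

text \<open>Labelings are total functions; only their values on the vertices matter.\<close>

definition labeling :: "'a sgraph \<Rightarrow> ('a \<Rightarrow> nat) \<Rightarrow> bool" where
  "labeling G f \<longleftrightarrow> (\<forall>x\<in>verts G. 1 \<le> f x)"

definition feasible :: "'a sgraph \<Rightarrow> ('a \<Rightarrow> nat) \<Rightarrow> bool" where
  "feasible G f \<longleftrightarrow> labeling G f \<and>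
     (\<forall>p. is_path G p \<and> hd p \<noteq> last p \<and> f (hd p) = f (last p) \<longrightarrow>
        (\<exists>x\<in>set p. f (hd p) < f x))"

definition tree_depth :: "'a sgraph \<Rightarrow> nat" where
  "tree_depth G = (LEAST k. \<exists>f. feasible G f \<and> f ` verts G \<subseteq> {1..k})"

definition delete_vertex :: "'a sgraph \<Rightarrow> 'a \<Rightarrow> 'a sgraph" where
  "delete_vertex G x = \<lparr>verts = verts G - {x}, edges = {e \<in> edges G. x \<notin> e}\<rparr>"

definition delete_edge :: "'a sgraph \<Rightarrow> 'a set \<Rightarrow> 'a sgraph" where
  "delete_edge G e = \<lparr>verts = verts G, edges = edges G - {e}\<rparr>"

text \<open>
  Contraction of the edge \<open>{x, y}\<close>; the merged vertex is represented by \<open>x\<close>.  The condition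
  \<open>card e = 2\<close> discards loops, and parallel edges coincide as sets.
\<close>

definition contract_edge :: "'a sgraph \<Rightarrow> 'a \<Rightarrow> 'a \<Rightarrow> 'a sgraph" where
  "contract_edge G x y =
     \<lparr>verts = verts G - {y},
      edges = {e \<in> (\<lambda>d. (\<lambda>z. if z = y then x else z) ` d) ` edges G. card e = 2}\<rparr>"

inductive minor_step :: "'a sgraph \<Rightarrow> 'a sgraph \<Rightarrow> bool" for G :: "'a sgraph" where
  delete_vertex: "x \<in> verts G \<Longrightarrow> minor_step G (delete_vertex G x)"
| delete_edge: "e \<in> edges G \<Longrightarrow> minor_step G (delete_edge G e)"
| contract_edge: "{x, y} \<in> edges G \<Longrightarrow> minor_step G (contract_edge G x y)"

text \<open>
  Every proper minor of \<open>G\<close> is, up to isomorphism, obtained from \<open>G\<close> by a nonempty sequence of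
  these operations, so it suffices to represent minors on the vertex type of \<open>G\<close>.
\<close>

definition proper_minor :: "'a sgraph \<Rightarrow> 'a sgraph \<Rightarrow> bool" where
  "proper_minor H G \<longleftrightarrow> minor_step\<^sup>+\<^sup>+ G H"

definition critical :: "nat \<Rightarrow> 'a sgraph \<Rightarrow> bool" where
  "critical k G \<longleftrightarrow> tree_depth G = k \<and> (\<forall>H. proper_minor H G \<longrightarrow> tree_depth H < k)"

definition one_unique_vertex :: "'a sgraph \<Rightarrow> 'a \<Rightarrow> bool" where
  "one_unique_vertex G v \<longleftrightarrow> v \<in> verts G \<and>
     (\<exists>f. feasible G f \<and> f ` verts G \<subseteq> {1..tree_depth G} \<and> {x \<in> verts G. f x = 1} = {v})"

definition one_unique :: "'a sgraph \<Rightarrow> bool" where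
  "one_unique G \<longleftrightarrow> (\<forall>v\<in>verts G. one_unique_vertex G v)"

lemma simple_graph_complete_graph: "finite V \<Longrightarrow> simple_graph (complete_graph V)"
  by (auto simp: simple_graph_def complete_graph_def)

lemma simple_graph_subdivide:
  assumes "simple_graph G" "F \<subseteq> edges G"
  shows "simple_graph (subdivide G F)"
proof -
  have V: "finite (verts G)" and E: "\<And>e. e \<in> edges G \<Longrightarrow> e \<subseteq> verts G \<and> card e = 2"
    using assms(1) by (auto simp: simple_graph_def)
  have "F \<subseteq> Pow (verts G)" using E assms(2) by blast
  then have "finite F" using V by (meson finite_Pow_iff finite_subset)
  then show ?thesis
    using V E assms(2) by (fastforce simp: simple_graph_def subdivide_def card_image)
qed

lemma simple_graph_minor_step:
  assumes "minor_step G H" "simple_graph G"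
  shows "simple_graph H"
  using assms
proof cases
  case (contract_edge x y)
  have xy: "x \<in> verts G" "x \<noteq> y"
    using contract_edge(2) assms(2) by (force simp: simple_graph_def)+
  show ?thesis
    using assms(2) xy contract_edge(1) unfolding simple_graph_def contract_edge_def by fastforce
qed (auto simp: simple_graph_def delete_vertex_def delete_edge_def)

lemma simple_graph_proper_minor:
  "proper_minor H G \<Longrightarrow> simple_graph G \<Longrightarrow> simple_graph H"
  unfolding proper_minor_def
  by (induction rule: tranclp_induct) (auto intro: simple_graph_minor_step)

end

(* Write W for the clique left after removing the centre v, m = n - 1 for its size and s w for the
   middle vertex of the edge vw. A labeling with only m + 1 labels has its top label on a clique
   vertex, since otherwise W uses 1, ..., m and the labels at the two lowest clique vertices force a
   conflict; removing that vertex gives a descent to m = 2. All upper bounds come from labelings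
   in which most of the clique (and possibly v) gets distinct high labels, so that only labels 1
   and 2 on a forest of stars and short paths remain to be checked. *)

theory Submission
  imports Defs
begin

text \<open>The constants come from one count. Give distinct high labels to a set \<open>T\<close>
  and let only the labels 1 and 2 occur outside it. For the graph itself \<open>T\<close> consists
  of \<open>c\<close> and all of \<open>W\<close> but one vertex, which costs m + 2 = n + 1 labels.
  After one minor operation some \<open>T\<close> with m - 1 vertices suffices: outside it the
  labels 1 and 2 have a single conflict, and the operation destroys exactly that one.

  Contractions are never labeled directly. A labeling of the original graph that agrees on the two
  ends of the contracted edge induces one of the contraction, and all conflicts are checked before
  contracting.

  The bound n >= 4 enters where the centre is excluded: the count there gives m <= 2. For m = 2 the
  graph is a 5-cycle, in which the centre looks like every other vertex and hence is
  1-unique.\<close>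

section \<open>Feasibility as separation in low-label subgraphs\<close>

text \<open>Its reachability classes are the components of the subgraph induced on the labels at
  most \<open>l\<close>. A conflict thus becomes membership in a transitive closure, with no
  distinctness of a vertex list to maintain.\<close>

definition low_adj :: "'a sgraph \<Rightarrow> ('a \<Rightarrow> nat) \<Rightarrow> nat \<Rightarrow> 'a rel" where
  "low_adj G f l = {(a, b). {a, b} \<in> edges G \<and> f a \<le> l \<and> f b \<le> l}"

lemma path_imp_rtrancl_low_adj:
  assumes "is_path G p" "\<forall>x\<in>set p. f x \<le> l"
  shows "(hd p, last p) \<in> (low_adj G f l)\<^sup>*"
  using assms
proof (induction p)
  case (Cons a p)
  show ?case
  proof (cases "p = []")
    case False
    then obtain b q where p: "p = b # q" by (cases p) auto
    have "(a, b) \<in> low_adj G f l"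
      using Cons.prems by (auto simp: p is_path_def low_adj_def)
    moreover have "(b, last p) \<in> (low_adj G f l)\<^sup>*"
      using Cons by (auto simp: p is_path_def)
    ultimately show ?thesis
      using False by (auto intro: converse_rtrancl_into_rtrancl)
  qed simp
qed (simp add: is_path_def)

lemma rtrancl_low_adj_imp_path:
  assumes "simple_graph G" "(a, b) \<in> (low_adj G f l)\<^sup>*" "b \<in> verts G" "f b \<le> l"
  shows "\<exists>p. is_path G p \<and> hd p = a \<and> last p = b \<and> (\<forall>x\<in>set p. f x \<le> l)"
  using assms(2)
proof (induction rule: converse_rtrancl_induct)
  case base
  then show ?case using assms(3,4) by (intro exI[of _ "[b]"]) (auto simp: is_path_def)
next
  case (step a a')
  then obtain p where p: "is_path G p" "hd p = a'" "last p = b" "\<forall>x\<in>set p. f x \<le> l"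
    by blast
  show ?case
  proof (cases "a \<in> set p")
    case True
    \<comment> \<open>The walk returns to \<open>a\<close>: dropping everything before that visit
      keeps the list distinct.\<close>
    then obtain xs ys where "p = xs @ a # ys" by (meson split_list)
    then show ?thesis
      using p by (intro exI[of _ "a # ys"]) (auto simp: is_path_def successively_append_iff)
  next
    case False
    have "a \<in> verts G" using step(1) assms(1) by (auto simp: low_adj_def simple_graph_def)
    then show ?thesis
      using p False step(1)
      by (intro exI[of _ "a # p"]) (auto simp: is_path_def low_adj_def successively_Cons)
  qed
qed

lemma feasible_iff:
  assumes "simple_graph G"
  shows "feasible G f \<longleftrightarrow> labeling G f \<and>
    (\<forall>a\<in>verts G. \<forall>b\<in>verts G. a \<noteq> b \<and> f a = f b \<longrightarrow> (a, b) \<notin> (low_adj G f (f a))\<^sup>*)"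
  (is "_ \<longleftrightarrow> _ \<and> ?Q")
proof -
  have "?Q" if f: "feasible G f"
  proof (intro ballI impI notI)
    fix a b assume ab: "a \<in> verts G" "b \<in> verts G" "a \<noteq> b \<and> f a = f b"
      and "(a, b) \<in> (low_adj G f (f a))\<^sup>*"
    from rtrancl_low_adj_imp_path[OF assms this(4) ab(2)] ab(3)
    obtain p where "is_path G p" "hd p = a" "last p = b" "\<forall>x\<in>set p. f x \<le> f a" by auto
    then show False using f ab(3) unfolding feasible_def by (metis leD)
  qed
  moreover have "feasible G f" if "labeling G f" ?Q
    unfolding feasible_def
  proof (intro conjI allI impI)
    fix p assume p: "is_path G p \<and> hd p \<noteq> last p \<and> f (hd p) = f (last p)"
    then have "hd p \<in> verts G" "last p \<in> verts G" by (auto simp: is_path_def)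
    then have "(hd p, last p) \<notin> (low_adj G f (f (hd p)))\<^sup>*" using p that(2) by blast
    then show "\<exists>x\<in>set p. f (hd p) < f x"
      using path_imp_rtrancl_low_adj p by (metis not_le)
  qed fact
  ultimately show ?thesis unfolding feasible_def by blast
qed

lemma rtrancl_low_adj_mono:
  assumes "(a, b) \<in> (low_adj G f l)\<^sup>*" "edges G \<subseteq> edges G'" "\<And>z. f z \<le> l \<Longrightarrow> f' z \<le> l"
  shows "(a, b) \<in> (low_adj G' f' l)\<^sup>*"
proof -
  have "low_adj G f l \<subseteq> low_adj G' f' l" using assms(2,3) by (auto simp: low_adj_def)
  then show ?thesis using assms(1) rtrancl_mono by blast
qed

section \<open>Tree-depth bounds under minor operations\<close>

text \<open>Bounds are handled as existence of a labeling, because the \<open>LEAST\<close> in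
  \<open>tree_depth\<close> can be exploited only once some bound is known.\<close>

definition td_le :: "'a sgraph \<Rightarrow> nat \<Rightarrow> bool" where
  "td_le G k \<longleftrightarrow> (\<exists>f. feasible G f \<and> f ` verts G \<subseteq> {1..k})"

lemma tree_depth_le: "td_le G k \<Longrightarrow> tree_depth G \<le> k"
  unfolding td_le_def tree_depth_def by (rule Least_le)

lemma td_le_tree_depth: "td_le G k \<Longrightarrow> td_le G (tree_depth G)"
  unfolding td_le_def tree_depth_def by (rule LeastI)

lemma td_le_mono: "td_le G k \<Longrightarrow> k \<le> l \<Longrightarrow> td_le G l"
  unfolding td_le_def
  by (meson atLeastatMost_subset_iff order_refl order_trans)

lemma td_le_subgraph:
  assumes "td_le G k" "verts G' \<subseteq> verts G" "edges G' \<subseteq> edges G"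
  shows "td_le G' k"
proof -
  have "is_path G p" if "is_path G' p" for p
    using that assms(2,3) by (auto simp: is_path_def elim!: successively_mono)
  then show ?thesis
    using assms unfolding td_le_def feasible_def labeling_def by (smt (verit) image_mono order_trans subset_iff)
qed

text \<open>The pair \<open>x\<close>, \<open>y\<close> is exempt because contracting the edge between them merges it;
  with \<open>x = y\<close> this is plain feasibility.\<close>

definition feasible_except :: "'a sgraph \<Rightarrow> 'a \<Rightarrow> 'a \<Rightarrow> ('a \<Rightarrow> nat) \<Rightarrow> bool" where
  "feasible_except G x y f \<longleftrightarrow> labeling G f \<and> (\<forall>a\<in>verts G. \<forall>b\<in>verts G.
     a \<noteq> b \<and> f a = f b \<and> {a, b} \<noteq> {x, y} \<longrightarrow> (a, b) \<notin> (low_adj G f (f a))\<^sup>*)"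

lemma feasible_except_refl: "simple_graph G \<Longrightarrow> feasible_except G x x f \<longleftrightarrow> feasible G f"
  by (auto simp: feasible_except_def feasible_iff)

text \<open>An edge of the contraction lifts to a walk of the original graph that may detour through
  \<open>{x, y}\<close>. As \<open>x\<close> and \<open>y\<close> carry the same label, the detour
  is available at every level at which the merged vertex is.\<close>

lemma feasible_contract_edge:
  assumes G: "simple_graph G" and xy: "{x, y} \<in> edges G" and f: "feasible_except G x y f" "f x = f y"
  shows "feasible (contract_edge G x y) f"
proof -
  have sg: "simple_graph (contract_edge G x y)"
    by (rule simple_graph_minor_step[OF minor_step.contract_edge[OF xy] G])
  have lift: "(a, b) \<in> (low_adj G f l)\<^sup>*" if "(a, b) \<in> low_adj (contract_edge G x y) f l" for a b l
  proof -
    let ?r = "\<lambda>z. if z = y then x else z"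
    from that have ab: "f a \<le> l" "f b \<le> l" "{a, b} \<in> edges (contract_edge G x y)"
      by (auto simp: low_adj_def)
    then obtain d where d: "d \<in> edges G" "{a, b} = ?r ` d"
      by (auto simp: contract_edge_def)
    from d(1) G obtain p q where pq: "d = {p, q}" by (auto simp: simple_graph_def card_2_iff)
    then have "{a, b} = {?r p, ?r q}" using d(2) by auto
    then consider "a = ?r p" "b = ?r q" | "a = ?r q" "b = ?r p"
      unfolding doubleton_eq_iff by blast
    then obtain p q where pq: "{p, q} \<in> edges G" "a = ?r p" "b = ?r q"
      using d(1) pq that[of p q] that[of q p] by cases (simp_all only: insert_commute)
    have xyl: "(x, y) \<in> low_adj G f l" "(y, x) \<in> low_adj G f l" if "f x \<le> l"
      using xy f(2) that by (auto simp: low_adj_def insert_commute)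
    have "(a, p) \<in> (low_adj G f l)\<^sup>*" "(q, b) \<in> (low_adj G f l)\<^sup>*"
      using pq(2,3) ab(1,2) xyl by (auto split: if_splits)
    moreover have "(p, q) \<in> low_adj G f l"
      using pq ab(1,2) f(2) by (auto simp: low_adj_def split: if_splits)
    ultimately show ?thesis by (meson rtrancl.rtrancl_into_rtrancl rtrancl_trans)
  qed
  then have "(low_adj (contract_edge G x y) f l)\<^sup>* \<subseteq> (low_adj G f l)\<^sup>*" for l
    by (intro rtrancl_subset_rtrancl) auto
  moreover have V: "verts (contract_edge G x y) = verts G - {y}" by (simp add: contract_edge_def)
  moreover have "(a, b) \<notin> (low_adj G f (f a))\<^sup>*"
    if "a \<in> verts G - {y}" "b \<in> verts G - {y}" "a \<noteq> b" "f a = f b" for a b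
  proof -
    have "{a, b} \<noteq> {x, y}" using that by (auto simp: doubleton_eq_iff)
    then show ?thesis using f(1) that by (auto simp: feasible_except_def)
  qed
  moreover have "labeling (contract_edge G x y) f"
    using f(1) V by (auto simp: feasible_except_def labeling_def)
  ultimately show ?thesis unfolding feasible_iff[OF sg] by blast
qed

text \<open>The merged vertex receives the larger of the two labels.\<close>

lemma td_le_contract_edge:
  assumes G: "simple_graph G" and xy: "{x, y} \<in> edges G" and "td_le G k"
  shows "td_le (contract_edge G x y) k"
proof -
  obtain f where f: "feasible G f" "f ` verts G \<subseteq> {1..k}" using assms(3) by (auto simp: td_le_def)
  let ?m = "max (f x) (f y)"
  let ?g = "f(x := ?m, y := ?m)"
  have V: "x \<in> verts G" "y \<in> verts G" using G xy by (auto simp: simple_graph_def)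
  have lab: "labeling G ?g" using f(1) by (auto simp: feasible_iff[OF G] labeling_def le_max_iff_disj)
  have xyl: "(x, y) \<in> low_adj G f l" "(y, x) \<in> low_adj G f l" if "?m \<le> l" for l
    using xy that by (auto simp: low_adj_def insert_commute)
  have fe: "feasible_except G x y ?g"
    unfolding feasible_except_def
  proof (intro conjI ballI impI notI)
    fix a b assume ab: "a \<in> verts G" "b \<in> verts G" "a \<noteq> b \<and> ?g a = ?g b \<and> {a, b} \<noteq> {x, y}"
      and "(a, b) \<in> (low_adj G ?g (?g a))\<^sup>*"
    then have r: "(a, b) \<in> (low_adj G f (?g a))\<^sup>*"
      by (elim rtrancl_low_adj_mono) (auto split: if_splits)
    \<comment> \<open>\<open>rep\<close> moves either end of the contracted edge to the end that
      already had the larger label. Then \<open>f (rep z)\<close> is the new label of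
      \<open>z\<close>, and a conflict of the new labeling becomes one of \<open>f\<close>.\<close>
    define rep where "rep z = (if z = x \<or> z = y then (if f x \<le> f y then y else x) else z)" for z
    have rep: "f (rep z) = ?g z" "(rep z, z) \<in> (low_adj G f (?g z))\<^sup>*"
      "(z, rep z) \<in> (low_adj G f (?g z))\<^sup>*" for z
      using xyl[of ?m] by (auto simp: rep_def)
    have "(rep a, rep b) \<in> (low_adj G f (f (rep a)))\<^sup>*"
      using r rep[of a] rep[of b] ab(3) by (metis rtrancl_trans)
    moreover have "rep a \<noteq> rep b" "rep a \<in> verts G" "rep b \<in> verts G"
      using ab V by (auto simp: rep_def)
    moreover have "f (rep a) = f (rep b)" using ab(3) rep(1) by metis
    ultimately show False using f(1) by (auto simp: feasible_iff[OF G])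
  qed (fact lab)
  have "?g x = ?g y" by simp
  from feasible_contract_edge[OF G xy fe this]
  have "feasible (contract_edge G x y) ?g" .
  moreover have "?g ` verts (contract_edge G x y) \<subseteq> {1..k}"
    using f(2) V by (auto simp: contract_edge_def image_subset_iff le_max_iff_disj)
  ultimately show ?thesis unfolding td_le_def by blast
qed

lemma td_le_minor_step:
  assumes "minor_step G H" "simple_graph G" "td_le G k"
  shows "td_le H k"
  using assms
proof cases
  case (contract_edge x y)
  then show ?thesis using td_le_contract_edge[OF assms(2) contract_edge(2) assms(3)] by simp
qed (auto intro!: td_le_subgraph[OF assms(3)] simp: delete_vertex_def delete_edge_def)

text \<open>Bounds survive further minor operations, so only the first operation of a sequence has
  to be examined.\<close>

lemma critical_Suc:
  assumes "simple_graph G" "tree_depth G = Suc k" "\<And>H. minor_step G H \<Longrightarrow> td_le H k"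
  shows "critical (Suc k) G"
  unfolding critical_def
proof (intro conjI allI impI)
  fix H assume "proper_minor H G"
  then have "minor_step\<^sup>+\<^sup>+ G H" by (simp add: proper_minor_def)
  then have "simple_graph H \<and> td_le H k"
    by (induction rule: tranclp_induct)
      (use assms in \<open>auto intro: simple_graph_minor_step td_le_minor_step\<close>)
  then show "tree_depth H < Suc k" using tree_depth_le by (auto simp: less_Suc_eq_le)
qed fact

section \<open>Extending a partial labeling by distinct high labels\<close>

text \<open>A separating colouring certifies that \<open>a\<close> and \<open>b\<close> are not joined by a path outside \<open>T\<close>
  with labels at most \<open>f a\<close>, without exhibiting the components.\<close>

definition low_separated :: "'a set set \<Rightarrow> 'a set \<Rightarrow> ('a \<Rightarrow> nat) \<Rightarrow> 'a \<Rightarrow> 'a \<Rightarrow> bool" where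
  "low_separated E T f a b \<longleftrightarrow> (\<exists>d :: 'a \<Rightarrow> 'a. d a \<noteq> d b \<and>
     (\<forall>p q. {p, q} \<in> E \<and> p \<notin> T \<and> q \<notin> T \<and> f p \<le> f a \<and> f q \<le> f a \<longrightarrow> d p = d q))"

text \<open>The labels on \<open>T\<close> exceed \<open>k\<close> and are pairwise distinct, so no
  conflict starts in \<open>T\<close>. A walk between vertices outside \<open>T\<close> whose labels
  stay at most \<open>k\<close> avoids \<open>T\<close>, and the separating colouring is constant
  along it.\<close>

lemma feasible_except_extend:
  assumes "finite T" "T \<subseteq> verts G"
    and f: "\<And>a. a \<in> verts G - T \<Longrightarrow> f a \<in> {1..k}"
    and col: "\<And>a b. a \<in> verts G - T \<Longrightarrow> b \<in> verts G - T \<Longrightarrow> a \<noteq> b \<Longrightarrow> f a = f b \<Longrightarrow> {a, b} \<noteq> {x, y} \<Longrightarrow>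
      low_separated (edges G) T f a b"
  obtains g where "feasible_except G x y g" "g ` verts G \<subseteq> {1..k + card T}"
    "\<And>a. a \<notin> T \<Longrightarrow> g a = f a" "\<And>a. a \<in> T \<Longrightarrow> k < g a"
proof -
  obtain h where h: "bij_betw h T {k + 1..k + card T}"
    using finite_same_card_bij[of T "{k + 1..k + card T}"] assms(1) by auto
  define g where "g a = (if a \<in> T then h a else f a)" for a
  have hT: "k < h a \<and> h a \<le> k + card T" if "a \<in> T" for a
    using bij_betwE[OF h] that by auto
  have "(a, b) \<notin> (low_adj G g (g a))\<^sup>*"
    if ab: "a \<in> verts G" "b \<in> verts G" "a \<noteq> b" "g a = g b" "{a, b} \<noteq> {x, y}" for a b
  proof -
    have T: "a \<notin> T" "b \<notin> T"
      using ab(1-4) hT[of a] hT[of b] f[of a] f[of b] bij_betw_imp_inj_on[OF h]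
      by (auto simp: g_def inj_on_def split: if_splits)
    then obtain c :: "'a \<Rightarrow> 'a" where c: "c a \<noteq> c b"
      "\<And>p q. {p, q} \<in> edges G \<Longrightarrow> p \<notin> T \<Longrightarrow> q \<notin> T \<Longrightarrow> f p \<le> f a \<Longrightarrow> f q \<le> f a \<Longrightarrow> c p = c q"
      using col[of a b] ab T unfolding low_separated_def g_def by auto
    have fa: "f a \<le> k" using f[of a] T ab by auto
    have "c z = c a" if "(a, z) \<in> (low_adj G g (g a))\<^sup>*" for z
      using that
    proof induction
      case (step p q)
      then show ?case
        using c(2)[of p q] T fa hT[of p] hT[of q]
        by (auto simp: low_adj_def g_def split: if_splits)
    qed simp
    then show ?thesis using c(1) by metis
  qed
  moreover have ran: "g a \<in> {1..k + card T}" if "a \<in> verts G" for a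
    using that f[of a] hT[of a] by (auto simp: g_def)
  ultimately have "feasible_except G x y g"
    by (auto simp: feasible_except_def labeling_def)
  then show ?thesis
  proof (rule that)
    show "g ` verts G \<subseteq> {1..k + card T}" using ran by blast
  qed (use hT in \<open>auto simp: g_def\<close>)
qed

lemma td_leI:
  assumes "simple_graph G" "finite T" "T \<subseteq> verts G"
    and "\<And>a. a \<in> verts G - T \<Longrightarrow> f a \<in> {1..k}"
    and "\<And>a b. a \<in> verts G - T \<Longrightarrow> b \<in> verts G - T \<Longrightarrow> a \<noteq> b \<Longrightarrow> f a = f b \<Longrightarrow>
      low_separated (edges G) T f a b"
  shows "td_le G (k + card T)"
proof -
  obtain g where "feasible_except G undefined undefined g" "g ` verts G \<subseteq> {1..k + card T}"
    using feasible_except_extend[where f = f and k = k and T = T and x = undefined and y = undefined] assms(2-5)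
    by metis
  then show ?thesis using feasible_except_refl[OF assms(1)] by (auto simp: td_le_def)
qed

lemma td_le_contractI:
  assumes "simple_graph G" "{x, y} \<in> edges G" "finite T" "T \<subseteq> verts G"
    and "\<And>a. a \<in> verts G - T \<Longrightarrow> f a \<in> {1..k}"
    and "f x = f y" "x \<notin> T" "y \<notin> T"
    and "\<And>a b. a \<in> verts G - T \<Longrightarrow> b \<in> verts G - T \<Longrightarrow> a \<noteq> b \<Longrightarrow> f a = f b \<Longrightarrow> {a, b} \<noteq> {x, y} \<Longrightarrow>
      low_separated (edges G) T f a b"
  shows "td_le (contract_edge G x y) (k + card T)"
proof -
  obtain g where g: "feasible_except G x y g" "g ` verts G \<subseteq> {1..k + card T}"
    "\<And>a. a \<notin> T \<Longrightarrow> g a = f a"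
    using feasible_except_extend[where f = f and k = k and T = T and x = x and y = y] assms(3-5,9)
    by metis
  have "feasible (contract_edge G x y) g"
    using feasible_contract_edge[OF assms(1,2) g(1)] g(3) assms(6-8) by metis
  moreover have "verts (contract_edge G x y) \<subseteq> verts G" by (auto simp: contract_edge_def)
  ultimately show ?thesis using g(2) unfolding td_le_def by blast
qed

section \<open>The graph as a clique joined to a centre through middle vertices\<close>

locale centred_clique =
  fixes H :: "'a sgraph" and W :: "'a set" and c :: 'a and s :: "'a \<Rightarrow> 'a"
  assumes finite_W: "finite W" and c_notin: "c \<notin> W" and inj_s: "inj_on s W"
    and s_notin: "s ` W \<inter> insert c W = {}"
    and verts_H: "verts H = insert c (W \<union> s ` W)"
    and edges_H: "edges H = {{a, b} | a b. a \<in> W \<and> b \<in> W \<and> a \<noteq> b} \<union>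
      {{c, s a} | a. a \<in> W} \<union> {{a, s a} | a. a \<in> W}"
begin

lemma adj_iff:
  "{p, q} \<in> edges H \<longleftrightarrow> p \<in> W \<and> q \<in> W \<and> p \<noteq> q \<or> p = c \<and> q \<in> s ` W \<or> q = c \<and> p \<in> s ` W \<or>
     p \<in> W \<and> q = s p \<or> q \<in> W \<and> p = s q"
  unfolding edges_H by (auto simp: doubleton_eq_iff)

lemma s_distinct [simp]:
  "a \<in> W \<Longrightarrow> s a \<noteq> c" "a \<in> W \<Longrightarrow> c \<noteq> s a" "a \<in> W \<Longrightarrow> s a \<notin> W"
  "a \<in> W \<Longrightarrow> b \<in> W \<Longrightarrow> s a = b \<longleftrightarrow> False" "a \<in> W \<Longrightarrow> b \<in> W \<Longrightarrow> b = s a \<longleftrightarrow> False"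
  "a \<in> W \<Longrightarrow> b \<in> W \<Longrightarrow> s a = s b \<longleftrightarrow> a = b" "c \<notin> W" "c \<notin> s ` W"
  using s_notin inj_s c_notin by (auto simp: inj_on_def)

lemma simple_H: "simple_graph H"
  using finite_W by (auto simp: simple_graph_def verts_H edges_H card_insert_if)

section \<open>Labelings of the graph and of its minors\<close>

text \<open>Outside \<open>T\<close> the only edge joins \<open>w\<close> and \<open>s w\<close>.
  One of its ends is \<open>z\<close> with label 1, the other has label 2, and the remaining middle
  vertices are isolated there. This yields both the upper bound on the tree-depth and the
  1-uniqueness of all vertices but the centre.\<close>

lemma non_centre_unique_label:
  assumes w: "w \<in> W" and z: "z = w \<or> z = s w"
  obtains g where "feasible H g" "g ` verts H \<subseteq> {1..card W + 2}" "{x \<in> verts H. g x = 1} = {z}"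
proof -
  define T where "T = insert c (W - {w})"
  define f where "f x = (if x = z then 1 else 2 :: nat)" for x
  have T: "finite T" "T \<subseteq> verts H" using finite_W by (auto simp: T_def verts_H)
  have z': "z \<in> verts H - T" using w z by (auto simp: T_def verts_H)
  have cT: "2 + card T = card W + 2"
    using card.remove[OF finite_W w] finite_W by (simp add: T_def)
  have f: "f a \<in> {1..2}" for a by (simp add: f_def)
  have col: "low_separated (edges H) T f a b"
    if ab: "a \<in> verts H - T" "b \<in> verts H - T" "a \<noteq> b" "f a = f b" for a b
  proof -
    define d where "d x = (if x = s w then w else x)" for x
    have "{a, b} \<noteq> {w, s w}" using ab z w by (auto simp: f_def doubleton_eq_iff split: if_splits)
    then have "d a \<noteq> d b" using ab(3) by (auto simp: d_def)
    moreover have "d p = d q" if "{p, q} \<in> edges H" "p \<notin> T" "q \<notin> T" for p q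
    proof -
      have "p \<noteq> c" "q \<noteq> c" "p \<in> W \<Longrightarrow> p = w" "q \<in> W \<Longrightarrow> q = w"
        using that by (auto simp: T_def)
      then have "p = w \<and> q = s w \<or> p = s w \<and> q = w" using that(1) unfolding adj_iff by metis
      then show ?thesis using w by (auto simp: d_def)
    qed
    ultimately show ?thesis unfolding low_separated_def by blast
  qed
  obtain g where g: "feasible_except H c c g" "g ` verts H \<subseteq> {1..2 + card T}"
    "\<And>a. a \<notin> T \<Longrightarrow> g a = f a" "\<And>a. a \<in> T \<Longrightarrow> 2 < g a"
    using feasible_except_extend[where f = f, OF T f col] by blast
  have "g x = 1 \<longleftrightarrow> x = z" for x
    using g(3,4)[of x] z' by (cases "x \<in> T") (auto simp: f_def)
  then have "{x \<in> verts H. g x = 1} = {z}" using z' by auto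
  then show ?thesis using that g(1,2) cT simple_H by (simp add: feasible_except_refl)
qed

text \<open>Outside \<open>T\<close> there is a star with centre \<open>c\<close> and the middle
  vertices as leaves, with \<open>w\<close> hanging from \<open>s w\<close>. The only conflict is
  between \<open>c\<close> and \<open>w\<close>, both labeled 2, along \<open>c\<close>,
  \<open>s w\<close>, \<open>w\<close>; deleting either edge of this path removes it.\<close>

lemma td_le_delete_spoke:
  assumes w: "w \<in> W" and e: "e = {c, s w} \<or> e = {w, s w}"
  shows "td_le (delete_edge H e) (Suc (card W))"
proof -
  define T where "T = W - {w}"
  define f where "f x = (if x = c \<or> x = w then 2 else 1 :: nat)" for x
  have E: "{p, q} \<in> edges (delete_edge H e) \<longleftrightarrow> {p, q} \<in> edges H \<and> {p, q} \<noteq> e" for p q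
    by (auto simp: delete_edge_def)
  have V: "verts (delete_edge H e) = verts H" by (simp add: delete_edge_def)
  have eH: "e \<in> edges H" using e w by (auto simp: adj_iff)
  have "td_le (delete_edge H e) (2 + card T)"
  proof (rule td_leI[where f = f])
    show "simple_graph (delete_edge H e)"
      by (rule simple_graph_minor_step[OF minor_step.delete_edge[OF eH] simple_H])
    fix a b assume ab: "a \<in> verts (delete_edge H e) - T" "b \<in> verts (delete_edge H e) - T"
      "a \<noteq> b" "f a = f b"
    show "low_separated (edges (delete_edge H e)) T f a b"
    proof (cases "a = c \<or> a = w")
      case True
      \<comment> \<open>The colour \<open>w\<close> marks what stays attached to \<open>w\<close>:
        also \<open>s w\<close> if the deleted edge is the one at \<open>c\<close>, otherwise
        \<open>w\<close> alone.\<close>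
      define d where "d x = (if x = w \<or> e = {c, s w} \<and> x = s w then w else c)" for x
      have "c \<noteq> w" using w c_notin by blast
      moreover have "a = c \<and> b = w \<or> a = w \<and> b = c"
        using ab True by (auto simp: f_def split: if_splits)
      ultimately have "d a \<noteq> d b" using w by (auto simp: d_def)
      moreover have "d p = d q" if "{p, q} \<in> edges H" "{p, q} \<noteq> e" "p \<notin> T" "q \<notin> T" for p q
        using that(1) unfolding adj_iff
      proof (elim disjE conjE)
        assume "p = c" "q \<in> s ` W"
        then show ?thesis using that(2) e w \<open>c \<noteq> w\<close> by (auto simp: d_def)
      next
        assume "q = c" "p \<in> s ` W"
        then show ?thesis using that(2) e w \<open>c \<noteq> w\<close> by (auto simp: d_def insert_commute)
      next
        assume "p \<in> W" "q = s p"
        then show ?thesis using that(2,3) e w by (auto simp: d_def T_def doubleton_eq_iff)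
      next
        assume "q \<in> W" "p = s q"
        then show ?thesis using that(2,4) e w by (auto simp: d_def T_def doubleton_eq_iff)
      qed (use that(3,4) in \<open>auto simp: T_def\<close>)
      ultimately show ?thesis unfolding low_separated_def E by blast
    next
      case False
      \<comment> \<open>At level 1 only middle vertices remain, and no two of them are
        adjacent.\<close>
      have "p = q" if "{p, q} \<in> edges H" "p \<notin> T" "q \<notin> T" "f p \<le> 1" "f q \<le> 1" for p q
        using that w by (auto simp: adj_iff T_def f_def split: if_splits)
      moreover have "f a = 1" using False by (simp add: f_def)
      ultimately show ?thesis unfolding low_separated_def E using ab(3) by (intro exI[of _ "\<lambda>x. x"]) simp
    qed
  qed (use finite_W in \<open>auto simp: V verts_H T_def f_def\<close>)
  moreover have "2 + card T = Suc (card W)" using card.remove[OF finite_W w] by (simp add: T_def)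
  ultimately show ?thesis by simp
qed

text \<open>Outside \<open>T\<close> there is the path \<open>s w\<close>, \<open>w\<close>,
  \<open>w'\<close>, \<open>s w'\<close> and isolated middle vertices, so the only conflict is
  between \<open>w\<close> and \<open>w'\<close>. Deletion removes their edge from \<open>E\<close>;
  contraction exempts the pair, so that \<open>a\<close> is never one of them. The conditional
  hypothesis on \<open>E\<close> covers both.\<close>

lemma clique_edge_colouring:
  assumes w: "w \<in> W" "w' \<in> W" "w \<noteq> w'"
  defines "T \<equiv> insert c (W - {w, w'})" and "f \<equiv> \<lambda>x. if x = w \<or> x = w' then 2 else 1 :: nat"
  assumes ab: "a \<in> verts H - T" "b \<in> verts H - T" "a \<noteq> b" "f a = f b"
    and E: "E \<subseteq> edges H" "a \<in> {w, w'} \<Longrightarrow> {w, w'} \<notin> E"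
  shows "low_separated E T f a b"
proof (cases "a \<in> {w, w'}")
  case True
  define d where "d x = (if x = s w then w else if x = s w' then w' else x)" for x
  from True ab have "{a, b} = {w, w'}" by (auto simp: f_def split: if_splits)
  then have "d a \<noteq> d b" using w by (auto simp: doubleton_eq_iff d_def)
  moreover have "d p = d q" if "{p, q} \<in> edges H" "{p, q} \<noteq> {w, w'}" "p \<notin> T" "q \<notin> T" for p q
  proof -
    have "p \<noteq> c" "q \<noteq> c" "p \<in> W \<Longrightarrow> p \<in> {w, w'}" "q \<in> W \<Longrightarrow> q \<in> {w, w'}"
      using that by (auto simp: T_def)
    then have "p \<in> {w, w'} \<and> q = s p \<or> q \<in> {w, w'} \<and> p = s q"
      using that(1,2) unfolding adj_iff by blast
    then show ?thesis using w by (auto simp: d_def)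
  qed
  moreover have "{p, q} \<in> edges H \<and> {p, q} \<noteq> {w, w'}" if "{p, q} \<in> E" for p q
    using that E True by (metis subsetD)
  ultimately show ?thesis unfolding low_separated_def by (intro exI[of _ d]) simp
next
  case False
  have "p = q" if "{p, q} \<in> edges H" "p \<notin> T" "q \<notin> T" "f p \<le> 1" "f q \<le> 1" for p q
  proof -
    have "p \<notin> insert c W" "q \<notin> insert c W"
      using that by (auto simp: T_def f_def split: if_splits)
    then show ?thesis using that(1) unfolding adj_iff by blast
  qed
  moreover have "f a = 1" using False by (auto simp: f_def)
  ultimately show ?thesis using ab(3) E(1) unfolding low_separated_def by (intro exI[of _ "\<lambda>x. x"]) auto
qed

lemma card_clique_edge:
  "w \<in> W \<Longrightarrow> w' \<in> W \<Longrightarrow> w \<noteq> w' \<Longrightarrow> 2 + card (insert c (W - {w, w'})) = Suc (card W)"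
proof -
  assume w: "w \<in> W" "w' \<in> W" "w \<noteq> w'"
  then have "card (W - {w, w'}) = card W - 2" using finite_W by (subst card_Diff_subset) auto
  moreover have "card {w, w'} \<le> card W" using w finite_W by (intro card_mono) auto
  ultimately show ?thesis using w finite_W by simp
qed

lemma td_le_delete_clique_edge:
  assumes w: "w \<in> W" "w' \<in> W" "w \<noteq> w'"
  shows "td_le (delete_edge H {w, w'}) (Suc (card W))"
proof -
  let ?f = "\<lambda>x. if x = w \<or> x = w' then 2 else 1 :: nat"
  let ?G = "delete_edge H {w, w'}" and ?T = "insert c (W - {w, w'})"
  have eH: "{w, w'} \<in> edges H" using w by (simp add: adj_iff)
  have "td_le ?G (2 + card ?T)"
  proof (rule td_leI[where f = ?f])
    show "simple_graph ?G"
      by (rule simple_graph_minor_step[OF minor_step.delete_edge[OF eH] simple_H])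
    show "low_separated (edges ?G) ?T ?f a b"
      if "a \<in> verts ?G - ?T" "b \<in> verts ?G - ?T" "a \<noteq> b" "?f a = ?f b" for a b
      using that by (intro clique_edge_colouring[OF w]) (auto simp: delete_edge_def)
  qed (use finite_W in \<open>auto simp: delete_edge_def verts_H\<close>)
  then show ?thesis using card_clique_edge[OF w] by simp
qed

lemma td_le_contract_clique_edge:
  assumes w: "w \<in> W" "w' \<in> W" "w \<noteq> w'"
  shows "td_le (contract_edge H w w') (Suc (card W))"
proof -
  let ?f = "\<lambda>x. if x = w \<or> x = w' then 2 else 1 :: nat"
  let ?T = "insert c (W - {w, w'})"
  have "td_le (contract_edge H w w') (2 + card ?T)"
  proof (rule td_le_contractI[where f = ?f])
    show "low_separated (edges H) ?T ?f a b"
      if "a \<in> verts H - ?T" "b \<in> verts H - ?T" "a \<noteq> b" "?f a = ?f b" "{a, b} \<noteq> {w, w'}" for a b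
      using that by (intro clique_edge_colouring[OF w]) (auto split: if_splits)
  qed (use finite_W w simple_H in \<open>auto simp: verts_H adj_iff\<close>)
  then show ?thesis using card_clique_edge[OF w] by simp
qed

text \<open>Either contraction turns the graph outside \<open>T\<close> into a star centred at
  \<open>c\<close>, with label 2 at the centre and 1 at the leaves. If \<open>c\<close> is itself
  merged, both ends must carry 2, whence the second disjunct in \<open>f\<close>.\<close>

lemma td_le_contract_spoke:
  assumes w: "w \<in> W" and xy: "{x, y} = {c, s w} \<or> {x, y} = {w, s w}"
  shows "td_le (contract_edge H x y) (Suc (card W))"
proof -
  define T where "T = W - {w}"
  define f where "f z = (if z = c \<or> z \<in> {x, y} \<and> c \<in> {x, y} then 2 else 1 :: nat)" for z
  have xy': "x = c \<and> y = s w \<or> x = s w \<and> y = c \<or> x = w \<and> y = s w \<or> x = s w \<and> y = w"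
    using xy by (auto simp: doubleton_eq_iff)
  have cw: "c \<noteq> w" using w c_notin by blast
  have "td_le (contract_edge H x y) (2 + card T)"
  proof (rule td_le_contractI[where f = f])
    show "f x = f y" "{x, y} \<in> edges H" using xy' w cw by (auto simp: f_def adj_iff)
    show "low_separated (edges H) T f a b"
      if ab: "a \<in> verts H - T" "b \<in> verts H - T" "a \<noteq> b" "f a = f b" "{a, b} \<noteq> {x, y}" for a b
    proof -
      define d where "d z = (if z = y then x else z)" for z
      have "f a = 1" using ab(3-5) w cw xy' by (auto simp: f_def split: if_splits)
      moreover have "d p = d q"
        if "{p, q} \<in> edges H" "p \<notin> T" "q \<notin> T" "f p \<le> 1" "f q \<le> 1" for p q
      proof -
        have "p \<noteq> c" "q \<noteq> c" "p \<in> W \<Longrightarrow> p = w" "q \<in> W \<Longrightarrow> q = w"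
          using that by (auto simp: f_def T_def split: if_splits)
        then have "p = w \<and> q = s w \<or> p = s w \<and> q = w" using that(1) unfolding adj_iff by metis
        then show ?thesis using xy' that(4,5) by (auto simp: d_def f_def split: if_splits)
      qed
      moreover have "d a \<noteq> d b" using ab(3,5) by (auto simp: d_def)
      ultimately show ?thesis unfolding low_separated_def by auto
    qed
  qed (use finite_W w xy' simple_H in \<open>auto simp: verts_H T_def f_def\<close>)
  moreover have "2 + card T = Suc (card W)" using card.remove[OF finite_W w] by (simp add: T_def)
  ultimately show ?thesis by simp
qed

lemma edge_cases:
  assumes "{x, y} \<in> edges H"
  obtains (clique) "x \<in> W" "y \<in> W" "x \<noteq> y"
    | (spoke) w where "w \<in> W" "{x, y} = {c, s w} \<or> {x, y} = {w, s w}"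
proof -
  consider "x \<in> W" "y \<in> W" "x \<noteq> y"
    | w where "w \<in> W" "x = c \<and> y = s w \<or> y = c \<and> x = s w \<or> x = w \<and> y = s w \<or> y = w \<and> x = s w"
    using assms unfolding adj_iff by fast
  then show ?thesis
  proof cases
    case 1
    then show ?thesis by (rule clique)
  next
    case (2 w)
    show ?thesis by (rule spoke[OF 2(1)]) (use 2(2) in \<open>auto simp: doubleton_eq_iff\<close>)
  qed
qed

lemma td_le_delete_edge:
  assumes e: "e \<in> edges H"
  shows "td_le (delete_edge H e) (Suc (card W))"
proof -
  obtain x y where e': "e = {x, y}" using simple_H e by (auto simp: simple_graph_def card_2_iff)
  then have "{x, y} \<in> edges H" using e by simp
  then show ?thesis
    unfolding e'
  proof (cases rule: edge_cases)
    case clique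
    then show "td_le (delete_edge H {x, y}) (Suc (card W))" by (rule td_le_delete_clique_edge)
  next
    case (spoke w)
    then show "td_le (delete_edge H {x, y}) (Suc (card W))" by (rule td_le_delete_spoke)
  qed
qed

lemma td_le_minor_step_H:
  assumes "minor_step H G" "W \<noteq> {}"
  shows "td_le G (Suc (card W))"
  using assms(1)
proof cases
  case (delete_vertex x)
  obtain w where w: "w \<in> W" using assms(2) by blast
  \<comment> \<open>No vertex is isolated, so deleting a vertex leaves a subgraph of some edge
    deletion.\<close>
  have "\<exists>e\<in>edges H. x \<in> e"
    using delete_vertex(2) w unfolding verts_H edges_H by blast
  then obtain e where "e \<in> edges H" "x \<in> e" by blast
  then show ?thesis unfolding delete_vertex(1)
    by (intro td_le_subgraph[OF td_le_delete_edge]) (auto simp: delete_vertex_def delete_edge_def)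
next
  case (contract_edge x y)
  from contract_edge(2) show ?thesis unfolding contract_edge(1)
  proof (cases rule: edge_cases)
    case clique
    then show "td_le (contract_edge H x y) (Suc (card W))" by (rule td_le_contract_clique_edge)
  next
    case (spoke w)
    then show "td_le (contract_edge H x y) (Suc (card W))" by (rule td_le_contract_spoke)
  qed
qed (simp add: td_le_delete_edge)

section \<open>The lower bound on the tree-depth\<close>

lemma edges_intro:
  "a \<in> W \<Longrightarrow> b \<in> W \<Longrightarrow> a \<noteq> b \<Longrightarrow> {a, b} \<in> edges H"
  "a \<in> W \<Longrightarrow> {c, s a} \<in> edges H" "a \<in> W \<Longrightarrow> {s a, c} \<in> edges H"
  "a \<in> W \<Longrightarrow> {a, s a} \<in> edges H" "a \<in> W \<Longrightarrow> {s a, a} \<in> edges H"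
  by (auto simp: adj_iff)

text \<open>Every conflict needed below runs along a walk of at most three edges. The conclusions
  are equations so that they clash directly with known distinctness.\<close>

lemma feasible_walks:
  assumes f: "feasible H f" and ab: "{a, b} \<in> edges H"
  shows "f a \<noteq> f b"
    and "{b, d} \<in> edges H \<Longrightarrow> f b \<le> f a \<Longrightarrow> f a = f d \<Longrightarrow> a = d"
    and "{b, d} \<in> edges H \<Longrightarrow> {d, e} \<in> edges H \<Longrightarrow> f b \<le> f a \<Longrightarrow> f d \<le> f a \<Longrightarrow> f a = f e \<Longrightarrow> a = e"
proof -
  have V: "{x, y} \<in> edges H \<Longrightarrow> x \<in> verts H \<and> y \<in> verts H \<and> x \<noteq> y" for x y
    using simple_H by (force simp: simple_graph_def)
  have eq: "x = y" if "(x, y) \<in> (low_adj H f (f x))\<^sup>*" "x \<in> verts H" "y \<in> verts H" "f x = f y" for x y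
    using f that by (auto simp: feasible_iff[OF simple_H])
  have step: "(x, y) \<in> low_adj H f l" if "{x, y} \<in> edges H" "f x \<le> l" "f y \<le> l" for x y l
    using that by (simp add: low_adj_def)
  show "f a \<noteq> f b" using eq[of a b] r_into_rtrancl[OF step[OF ab, of "f a"]] V[OF ab] by auto
  show "a = d" if "{b, d} \<in> edges H" "f b \<le> f a" "f a = f d"
    using eq[of a d] step[OF ab, of "f a"] step[OF that(1), of "f a"] V[OF ab] V[OF that(1)] that
    by (simp add: rtrancl_into_rtrancl[OF r_into_rtrancl])
  show "a = e" if "{b, d} \<in> edges H" "{d, e} \<in> edges H" "f b \<le> f a" "f d \<le> f a" "f a = f e"
    using eq[of a e] step[OF ab, of "f a"] step[OF that(1), of "f a"] step[OF that(2), of "f a"]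
      V[OF ab] V[OF that(2)] that
    by (simp add: rtrancl_into_rtrancl[OF rtrancl_into_rtrancl[OF r_into_rtrancl]])
qed

lemma inj_on_clique: "feasible H f \<Longrightarrow> inj_on f W"
  by (meson inj_onI feasible_walks(1) edges_intro(1))

text \<open>\<open>M = 1\<close> has to be excluded: the path \<open>c\<close>, \<open>s u\<close>,
  \<open>u\<close> admits the labels 1, 2, 1. The vertex \<open>s t\<close> stays in the conclusion
  because the descent still uses it at its last stage, after \<open>t\<close> is gone.\<close>

lemma top_label_in_clique:
  assumes f: "feasible H f" and U: "U \<subseteq> W" and M: "card U = M" "M \<ge> 2"
    and ran: "\<And>x. x \<in> insert c (U \<union> s ` U) \<Longrightarrow> f x \<in> {1..Suc M}"
  obtains t where "t \<in> U"
    "\<And>x. x \<in> insert c ((U - {t}) \<union> s ` (U - {t})) \<or> x = s t \<Longrightarrow> f x \<in> {1..M}"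
proof -
  note walk = feasible_walks[OF f]
  have le: "f x \<le> Suc M" if "x \<in> insert c (U \<union> s ` U)" for x
    using ran[OF that] by simp
  have finU: "finite U" using U finite_W finite_subset by blast
  have inj: "inj_on f U" using inj_on_clique[OF f] U inj_on_subset by blast
  have "\<exists>t\<in>U. f t = Suc M"
  proof (rule ccontr)
    assume no: "\<not> ?thesis"
    have "f u \<in> {1..M}" if "u \<in> U" for u
    proof -
      have "f u \<in> {1..Suc M}" using ran that by simp
      then show ?thesis using no that by (auto simp: le_Suc_eq)
    qed
    then have "f ` U \<subseteq> {1..M}" by blast
    moreover have "card (f ` U) = M" using inj M(1) by (simp add: card_image)
    ultimately have fU: "f ` U = {1..M}" by (intro card_subset_eq) auto
    then have "1 \<in> f ` U" "2 \<in> f ` U" using M(2) by auto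
    then obtain u0 u1 where u: "u0 \<in> U" "f u0 = 1" "u1 \<in> U" "f u1 = 2" by (metis imageE)
    then have uW: "u0 \<in> W" "u1 \<in> W" "u0 \<noteq> u1" using U by auto
    have onto: "\<exists>u\<in>U. f u = f x" if "x \<in> insert c (U \<union> s ` U)" "f x \<noteq> Suc M" for x
    proof -
      have "f x \<in> {1..M}" using ran[OF that(1)] that(2) by (auto simp: le_Suc_eq)
      then show ?thesis using fU by (metis imageE)
    qed
    \<comment> \<open>A smaller label would recur at some clique vertex \<open>u'\<close>, joined to
      \<open>s u0\<close> through \<open>u0\<close> of label 1.\<close>
    have s0: "f (s u0) = Suc M"
    proof (rule ccontr)
      assume "f (s u0) \<noteq> Suc M"
      then obtain u' where u': "u' \<in> U" "f u' = f (s u0)" using onto[of "s u0"] u by auto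
      then have "u' \<in> W" using U by blast
      show False
      proof (cases "u' = u0")
        case True
        then show False using walk(1)[OF edges_intro(4)[OF uW(1)]] u' by simp
      next
        case False
        have "f u' \<ge> 1" using fU u'(1) by auto
        then have "s u0 = u'"
          by (intro walk(2)[OF edges_intro(5) edges_intro(1)]) (use uW \<open>u' \<in> W\<close> False u' u in auto)
        then show False using \<open>u' \<in> W\<close> uW by simp
      qed
    qed
    \<comment> \<open>Otherwise \<open>s u1\<close>, \<open>u1\<close>, \<open>u0\<close>,
      \<open>s u0\<close> would join two top labels.\<close>
    have "f (s u1) \<noteq> Suc M"
    proof
      assume h: "f (s u1) = Suc M"
      have "s u1 = s u0"
        by (rule walk(3)[OF edges_intro(5) edges_intro(1) edges_intro(4)]) (use uW u h s0 M in auto)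
      then show False using uW by simp
    qed
    then obtain u' where u': "u' \<in> U" "f u' = f (s u1)" using onto[of "s u1"] u by auto
    have u'W: "u' \<in> W" using u' U by blast
    \<comment> \<open>A label other than 1 would recur at a clique vertex \<open>u'\<close> other
      than \<open>u1\<close>, hence be at least 3, and \<open>u1\<close> of label 2 would join the
      two.\<close>
    have s1: "f (s u1) = 1"
    proof (rule ccontr)
      assume h: "f (s u1) \<noteq> 1"
      have "f u' \<noteq> f u1" using walk(1)[OF edges_intro(4)[OF uW(2)]] u' by simp
      then have "u1 \<noteq> u'" by blast
      moreover have "f u' \<ge> 1" using fU u'(1) by auto
      ultimately have "s u1 = u'"
        by (intro walk(2)[OF edges_intro(5) edges_intro(1)]) (use uW u'W u' u h \<open>f u' \<noteq> f u1\<close> in auto)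
      then show False using u'W uW by simp
    qed
    \<comment> \<open>The neighbours \<open>s u0\<close> and \<open>s u1\<close> exclude the top
      label and 1 at \<open>c\<close>. Its label therefore recurs at a clique vertex
      \<open>x\<close>, reached through \<open>s u1\<close> and \<open>u1\<close> with labels 1 and
      2.\<close>
    have "f c \<noteq> Suc M" using walk(1)[OF edges_intro(2)[OF uW(1)]] s0 by simp
    then obtain x where x: "x \<in> U" "f x = f c" using onto[of c] by auto
    have xW: "x \<in> W" using x U by blast
    have "f c \<noteq> 1" using walk(1)[OF edges_intro(2)[OF uW(2)]] s1 by simp
    moreover have "f c \<ge> 1" using ran[of c] by simp
    ultimately have c2: "f c \<ge> 2" by simp
    have "c = x"
    proof (cases "x = u1")
      case True
      show ?thesis
        by (rule walk(2)[OF edges_intro(2) edges_intro(5)]) (use uW x s1 c2 True in auto)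
    next
      case False
      show ?thesis
        by (rule walk(3)[OF edges_intro(2)[OF uW(2)] edges_intro(5)[OF uW(2)] edges_intro(1)])
          (use uW xW x s1 c2 False u in auto)
    qed
    then show False using xW c_notin by blast
  qed
  then obtain t where t: "t \<in> U" "f t = Suc M" by blast
  have tW: "t \<in> W" using t U by blast
  \<comment> \<open>A second top label would be within two edges of \<open>t\<close>:
    \<open>c\<close> through \<open>s t\<close>, and \<open>s u\<close> through
    \<open>u\<close>.\<close>
  have below: "f x \<noteq> Suc M" if "x \<in> insert c (U \<union> s ` U)" "x \<noteq> t" for x
  proof
    assume h: "f x = Suc M"
    consider "x = c" | "x \<in> U" | u where "u \<in> U" "x = s u" using \<open>x \<in> insert c (U \<union> s ` U)\<close> by blast
    then show False
    proof cases
      case 1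
      have "c = t"
        by (rule walk(2)[OF edges_intro(2) edges_intro(5)]) (use tW t h 1 le in auto)
      then show False using tW c_notin by blast
    next
      case 2
      then show False using inj_onD[OF inj, of x t] t h \<open>x \<noteq> t\<close> by simp
    next
      case (3 u)
      then have uW: "u \<in> W" using U by blast
      have "s u = t"
      proof (cases "u = t")
        case True
        then show ?thesis using walk(1)[OF edges_intro(4)[OF tW]] h t 3 by simp
      next
        case False
        show ?thesis
          by (rule walk(2)[OF edges_intro(5) edges_intro(1)]) (use uW tW t h 3 le False in auto)
      qed
      then show False using uW tW by simp
    qed
  qed
  have other: "x \<in> insert c (U \<union> s ` U) \<and> x \<noteq> t"
    if "x \<in> insert c ((U - {t}) \<union> s ` (U - {t})) \<or> x = s t" for x
  proof -
    have "t \<noteq> c" using tW c_notin by blast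
    have "t \<notin> s ` U"
    proof
      assume "t \<in> s ` U"
      then have "t \<in> s ` W" using image_mono[OF U] by (rule subsetD[rotated])
      then show False using tW s_notin by auto
    qed
    have "x \<in> insert c (U \<union> s ` U)" "x \<in> s ` U \<or> x \<in> insert c (U - {t})"
      using that t(1) by auto
    then show ?thesis using \<open>t \<noteq> c\<close> \<open>t \<notin> s ` U\<close> by auto
  qed
  show ?thesis
  proof (rule that[OF t(1)])
    fix x assume "x \<in> insert c ((U - {t}) \<union> s ` (U - {t})) \<or> x = s t"
    from other[OF this] show "f x \<in> {1..M}" using ran[of x] below[of x] by (simp add: le_Suc_eq)
  qed
qed

text \<open>Removing the clique vertex with the top label leaves the same configuration with one label
  less; this is why the bound is stated for all subsets \<open>U\<close> of the clique.\<close>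

lemma no_small_labeling:
  assumes f: "feasible H f"
  shows "U \<subseteq> W \<Longrightarrow> card U = m + 2 \<Longrightarrow>
    (\<And>x. x \<in> insert c (U \<union> s ` U) \<Longrightarrow> f x \<in> {1..m + 3}) \<Longrightarrow> False"
proof (induction m arbitrary: U)
  note walk = feasible_walks[OF f]
  case 0
  obtain t where t: "t \<in> U"
    "\<And>x. x \<in> insert c ((U - {t}) \<union> s ` (U - {t})) \<or> x = s t \<Longrightarrow> f x \<in> {1..2}"
    using top_label_in_clique[OF f 0(1), of 2] 0(2,3) by (auto simp: numeral_3_eq_3)
  obtain u where u: "U - {t} = {u}"
    using 0(2) t(1) by (metis One_nat_def Suc_1 add_0 card_1_singletonE card_Diff_singleton diff_Suc_1)
  then have W: "u \<in> W" "t \<in> W" "u \<noteq> t" using t 0 by auto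
  \<comment> \<open>What is left is the path \<open>u\<close>, \<open>s u\<close>, \<open>c\<close>,
    \<open>s t\<close> with labels 1 and 2, but a path on four vertices has tree-depth 3.\<close>
  have ran: "f u \<in> {1..2}" "f (s u) \<in> {1..2}" "f c \<in> {1..2}" "f (s t) \<in> {1..2}"
    by (rule t(2); simp add: u)+
  have ne: "f u \<noteq> f (s u)" "f c \<noteq> f (s u)" "f c \<noteq> f (s t)"
    using walk(1) edges_intro W by metis+
  show False
  proof (cases "f c = 2")
    case True
    have "c = u" by (rule walk(2)[OF edges_intro(2) edges_intro(5)]) (use W True ran ne in auto)
    then show False using W c_notin by blast
  next
    case False
    have "s u = s t" by (rule walk(2)[OF edges_intro(3) edges_intro(2)]) (use W False ran ne in auto)
    then show False using W by simp
  qed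
next
  case (Suc m)
  have "card U = m + 3" "m + 3 \<ge> 2" using Suc.prems(2) by simp_all
  moreover have "f x \<in> {1..Suc (m + 3)}" if "x \<in> insert c (U \<union> s ` U)" for x
    using Suc.prems(3)[OF that] by simp
  ultimately obtain t where t: "t \<in> U"
    "\<And>x. x \<in> insert c ((U - {t}) \<union> s ` (U - {t})) \<or> x = s t \<Longrightarrow> f x \<in> {1..m + 3}"
    using top_label_in_clique[OF f Suc.prems(1)] by metis
  show False
  proof (rule Suc.IH)
    show "U - {t} \<subseteq> W" using Suc.prems(1) by blast
    show "card (U - {t}) = m + 2" using Suc.prems(2) t(1) by simp
  qed (use t(2) in blast)
qed

lemma tree_depth_H:
  assumes "card W \<ge> 2"
  shows "tree_depth H = card W + 2"
proof -
  obtain w where "w \<in> W" using assms by fastforce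
  then obtain g where "feasible H g" "g ` verts H \<subseteq> {1..card W + 2}"
    using non_centre_unique_label by blast
  then have td: "td_le H (card W + 2)" by (auto simp: td_le_def)
  have "\<not> td_le H (Suc (card W))"
  proof
    assume "td_le H (Suc (card W))"
    then obtain f where f: "feasible H f" "f ` verts H \<subseteq> {1..Suc (card W)}"
      by (auto simp: td_le_def)
    obtain m where m: "card W = m + 2" using assms by (metis add.commute le_Suc_ex)
    show False
    proof (rule no_small_labeling[OF f(1) subset_refl m])
      fix x assume "x \<in> insert c (W \<union> s ` W)"
      then have "f x \<in> {1..Suc (card W)}" using f(2) verts_H by blast
      then show "f x \<in> {1..m + 3}" using m by simp
    qed
  qed
  moreover have "td_le H (Suc (card W))" if "tree_depth H \<le> Suc (card W)"
    using td_le_mono[OF td_le_tree_depth[OF td] that] .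
  ultimately show ?thesis using tree_depth_le[OF td] by force
qed

section \<open>1-uniqueness and criticality\<close>

text \<open>If the centre alone has label 1, the middle vertices get distinct labels, as they pairwise
  communicate through it. Clique and middle vertices then each miss exactly one of the
  \<open>card W + 1\<close> labels above 1, and each \<open>w\<close> forces \<open>f w\<close> or \<open>f (s w)\<close> to be the label missed by
  the other side.\<close>

lemma centre_not_one_unique:
  assumes W3: "card W \<ge> 3"
  shows "\<not> one_unique_vertex H c"
proof
  assume "one_unique_vertex H c"
  then obtain f where f: "feasible H f" "f ` verts H \<subseteq> {1..card W + 2}" "{x \<in> verts H. f x = 1} = {c}"
    using tree_depth_H W3 by (auto simp: one_unique_vertex_def)
  note walk = feasible_walks[OF f(1)]
  let ?L = "{2..card W + 2}" and ?A = "f ` W" and ?B = "f ` s ` W"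
  have c1: "f c = 1" using f(3) by auto
  have ran: "f x \<in> ?L" if "x \<in> W \<union> s ` W" for x
  proof -
    have "x \<in> verts H" "x \<noteq> c" using that by (auto simp: verts_H)
    then have "f x \<in> {1..card W + 2}" "f x \<noteq> 1" using f(2,3) by blast+
    then show ?thesis by simp
  qed
  have injA: "inj_on f W" by (rule inj_on_clique[OF f(1)])
  have injB: "inj_on f (s ` W)"
  proof (rule inj_onI)
    fix x y assume xy: "x \<in> s ` W" "y \<in> s ` W" "f x = f y"
    then obtain a b where ab: "a \<in> W" "x = s a" "b \<in> W" "y = s b" by blast
    then show "x = y"
      using walk(2)[OF edges_intro(3)[OF ab(1)] edges_intro(2)[OF ab(3)]] xy(3) c1 ran[of x] xy(1) by simp
  qed
  have missed: "card (?L - C) = 1" if "C \<subseteq> ?L" "card C = card W" for C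
    using that by (simp add: card_Diff_subset finite_subset)
  have mA: "card (?L - ?A) = 1" using ran injA by (intro missed) (auto simp: card_image)
  have mB: "card (?L - ?B) = 1"
    using ran injB inj_s by (intro missed) (auto simp: card_image)
  \<comment> \<open>Otherwise \<open>f w\<close> recurs at some \<open>s a\<close> and
    \<open>f (s w)\<close> at some \<open>b\<close> in \<open>W\<close>. If \<open>f w\<close> is
    the larger of the two, \<open>w\<close>, \<open>s w\<close>, \<open>c\<close>,
    \<open>s a\<close> is a conflict; if not, \<open>s w\<close>, \<open>w\<close>, \<open>b\<close>
    is one.\<close>
  have dich: "f w \<in> ?L - ?B \<or> f (s w) \<in> ?L - ?A" if w: "w \<in> W" for w
  proof (rule ccontr)
    assume "\<not> ?thesis"
    then obtain a b where ab: "a \<in> W" "f w = f (s a)" "b \<in> W" "f (s w) = f b"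
      using ran w by blast
    show False
    proof (cases "f (s w) \<le> f w")
      case True
      have "w = s a"
        by (rule walk(3)[OF edges_intro(4) edges_intro(3) edges_intro(2)])
          (use w ab True c1 ran[of w] in auto)
      then show False using w ab by simp
    next
      case False
      then have "w \<noteq> b" using ab by auto
      have "s w = b"
        by (rule walk(2)[OF edges_intro(5) edges_intro(1)]) (use w ab False \<open>w \<noteq> b\<close> in auto)
      then show False using w ab by simp
    qed
  qed
  \<comment> \<open>By injectivity each of the two missed labels serves at most one
    \<open>w\<close>, so \<open>W\<close> would have at most two elements.\<close>
  let ?P = "{w \<in> W. f w \<in> ?L - ?B}" and ?Q = "{w \<in> W. f (s w) \<in> ?L - ?A}"
  have "card ?P \<le> card (?L - ?B)"
    by (rule card_inj_on_le[of f]) (use injA in \<open>auto intro: inj_on_subset\<close>)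
  moreover have "card ?Q \<le> card (?L - ?A)"
    by (rule card_inj_on_le[of "f \<circ> s"])
      (use comp_inj_on[OF inj_s injB] in \<open>auto intro: inj_on_subset\<close>)
  moreover have "card W \<le> card (?P \<union> ?Q)"
    using dich finite_W by (intro card_mono) auto
  ultimately show False using card_Un_le[of ?P ?Q] mA mB W3 by linarith
qed

lemma critical_H:
  assumes "card W \<ge> 2"
  shows "critical (card W + 2) H"
proof -
  have "W \<noteq> {}" using assms by auto
  then have "critical (Suc (Suc (card W))) H"
    using tree_depth_H[OF assms] by (intro critical_Suc[OF simple_H] td_le_minor_step_H) auto
  then show ?thesis by simp
qed

lemma one_unique_vertex_iff:
  assumes "card W \<ge> 3" "z \<in> verts H"
  shows "one_unique_vertex H z \<longleftrightarrow> z \<noteq> c"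
proof
  assume "z \<noteq> c"
  then obtain w where "w \<in> W" "z = w \<or> z = s w" using assms(2) by (auto simp: verts_H)
  then obtain g where "feasible H g" "g ` verts H \<subseteq> {1..card W + 2}" "{x \<in> verts H. g x = 1} = {z}"
    by (rule non_centre_unique_label)
  then show "one_unique_vertex H z"
    using tree_depth_H assms unfolding one_unique_vertex_def by auto
qed (use centre_not_one_unique[OF assms(1)] in blast)

end

section \<open>The subdivided complete graph as an instance\<close>

text \<open>The map \<open>s\<close> of the locale acts on vertices of the subdivided graph itself,
  so \<open>projl\<close> recovers the original vertex before the edge to \<open>v\<close> is
  formed.\<close>

lemma centred_clique_subdivide:
  assumes "finite V" "v \<in> V"
  shows "centred_clique (subdivide (complete_graph V) {e \<in> edges (complete_graph V). v \<in> e})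
    (Inl ` (V - {v})) (Inl v) (\<lambda>x. Inr {v, projl x})"
proof -
  define F where "F = {e \<in> edges (complete_graph V). v \<in> e}"
  define W where "W = (Inl ` (V - {v}) :: ('a + 'a set) set)"
  define s where "s = (\<lambda>x :: 'a + 'a set. Inr {v, projl x} :: 'a + 'a set)"
  let ?H = "subdivide (complete_graph V) F"
  have F: "F = (\<lambda>x. {v, x}) ` (V - {v})"
    using assms(2) by (auto simp: F_def complete_graph_def card_2_iff insert_commute)
  have E: "edges (complete_graph V) - F = {{a, b} | a b. a \<in> V - {v} \<and> b \<in> V - {v} \<and> a \<noteq> b}"
    by (auto simp: F_def complete_graph_def card_2_iff)
  have sW: "s ` W = Inr ` F" unfolding F W_def s_def by (simp add: image_image)
  have "centred_clique ?H W (Inl v) s"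
  proof
    show "inj_on s W" by (auto simp: inj_on_def doubleton_eq_iff W_def s_def)
    show "verts ?H = insert (Inl v) (W \<union> s ` W)"
      unfolding sW using assms(2) by (auto simp: subdivide_def complete_graph_def W_def)
    have "edges ?H = (`) Inl ` (edges (complete_graph V) - F) \<union> {{Inl x, Inr e} | x e. e \<in> F \<and> x \<in> e}"
      by (simp add: subdivide_def)
    moreover have "(`) Inl ` (edges (complete_graph V) - F) = {{a, b} | a b. a \<in> W \<and> b \<in> W \<and> a \<noteq> b}"
      unfolding E W_def by (auto simp: image_iff) (metis image_empty image_insert)
    moreover have "{{Inl x, Inr e} | x e. e \<in> F \<and> x \<in> e} =
        {{Inl v, s a} | a. a \<in> W} \<union> {{a, s a} | a. a \<in> W}" (is "?L = ?R")
    proof (rule set_eqI)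
      fix X
      have "X \<in> ?L \<longleftrightarrow> (\<exists>w\<in>V - {v}. X = {Inl v, Inr {v, w}} \<or> X = {Inl w, Inr {v, w}})"
        unfolding F by blast
      also have "\<dots> \<longleftrightarrow> X \<in> (\<lambda>a. {Inl v, s a}) ` W \<union> (\<lambda>a. {a, s a}) ` W"
        unfolding W_def s_def image_image by (simp only: sum.sel) blast
      also have "\<dots> \<longleftrightarrow> X \<in> ?R" by blast
      finally show "X \<in> ?L \<longleftrightarrow> X \<in> ?R" .
    qed
    ultimately show "edges ?H = {{a, b} | a b. a \<in> W \<and> b \<in> W \<and> a \<noteq> b} \<union>
        {{Inl v, s a} | a. a \<in> W} \<union> {{a, s a} | a. a \<in> W}"
      by (simp only: Un_assoc)
  qed (use assms in \<open>auto simp: W_def s_def\<close>)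
  then show ?thesis unfolding F_def W_def s_def .
qed

theorem theorem3p6:
  fixes V :: "'a set" and v :: 'a and n :: nat and H :: "('a + 'a set) sgraph"
  assumes "n \<ge> 4" and "finite V" and "card V = n" and "v \<in> V"
    and "H = subdivide (complete_graph V) {e \<in> edges (complete_graph V). v \<in> e}"
  shows "critical (n + 1) H \<and> \<not> one_unique H \<and>
    (\<forall>w\<in>verts H. \<not> one_unique_vertex H w \<longleftrightarrow> w = Inl v)"
proof -
  define W where "W = (Inl ` (V - {v}) :: ('a + 'a set) set)"
  interpret centred_clique H W "Inl v" "\<lambda>x. Inr {v, projl x}"
    unfolding assms(5) W_def by (rule centred_clique_subdivide) fact+
  have W: "card W = n - 1" using assms(2-4) by (simp add: W_def card_image)
  then have "critical (n + 1) H" using critical_H assms(1) by simp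
  moreover have "one_unique_vertex H w \<longleftrightarrow> w \<noteq> Inl v" if "w \<in> verts H" for w
    using one_unique_vertex_iff[OF _ that] W assms(1) by simp
  moreover have "Inl v \<in> verts H" by (simp add: verts_H)
  ultimately show ?thesis unfolding one_unique_def by blast
qed

end
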